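(* Let $n\ge3$ and $N\ge1$ be integers, let $Q\subset\mathbb{R}^n$ be the unit Euclidean ball, and let $\xi$ be a random vector uniformly distributed over $Q$. Let $c_1,c_2\in\mathbb{R}^n$ satisfy $\|c_1\|=\|c_2\|=1$ and $c_1^\top c_2=0$, and let $g(x)=(c_1^\top x,\;c_2^\top x)^\top$. Let $\eta=\max_{i=1,\dots,N}\rho^{(i)}$ with $\rho^{(i)}=\|g(\xi^{(i)})\|^2$ be the empirical maximum of the function $\rho(x)=\|g(x)\|^2$ from a multisample $\xi^{(1)},\dots,\xi^{(N)}$ of size $N$. Then the expectation of $\eta$ is $$ \mathsf{E}(\eta)=1-\frac2n\,B\Bigl(\frac2n,\,N+1\Bigr), $$ where $B(\cdot,\cdot)$ is the beta function.
   Context: $\|\cdot\|$ is the Euclidean norm. The multisample $\xi^{(1)},\dots,\xi^{(N)}$ consists of independent copies of $\xi$. The beta function is $B(a,b)=\int_0^1t^{a-1}(1-t)^{b-1}\,dt$ for $a,b>0$. *)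

theory Defs
  imports "HOL-Probability.Probability"
begin

definition g_map :: "real ^ 'n \<Rightarrow> real ^ 'n \<Rightarrow> real ^ 'n \<Rightarrow> real ^ 2" where
  "g_map c1 c2 x = vector [c1 \<bullet> x, c2 \<bullet> x]"

definition rho :: "real ^ 'n \<Rightarrow> real ^ 'n \<Rightarrow> real ^ 'n \<Rightarrow> real" where
  "rho c1 c2 x = (norm (g_map c1 c2 x))\<^sup>2"

text \<open>The multisample consists of the random vectors \<open>X 1, \<dots>, X N\<close>; the
  remaining members of the family \<open>X\<close> are ignored. Meaningful for \<open>N \<ge> 1\<close> only.\<close>

definition empirical_max ::
  "(real ^ 'n \<Rightarrow> real) \<Rightarrow> nat \<Rightarrow> (nat \<Rightarrow> 'a \<Rightarrow> real ^ 'n) \<Rightarrow> 'a \<Rightarrow> real" where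
  "empirical_max r N X \<omega> = Max ((\<lambda>i. r (X i \<omega>)) ` {1..N})"

text \<open>The library defines \<open>Beta\<close> through \<open>Gamma\<close>. For positive real arguments it is
  Euler's integral.\<close>

lemma Beta_eq_Euler_integral:
  fixes a b :: real
  assumes "a > 0" and "b > 0"
  shows "Beta a b = integral {0..1} (\<lambda>t. t powr (a - 1) * (1 - t) powr (b - 1))"
  using has_integral_Beta_real[OF assms] by (simp add: integral_unique)

end

theory Submission
  imports Defs
begin

text \<open>Slicing the ball by planes parallel to the span of \<open>c1\<close> and \<open>c2\<close>, the part of a slice outside
  the cylinder \<open>rho \<le> t\<close> is an annulus, whose area equals that of the corresponding slice of the ball
  of radius \<open>sqrt (1 - t)\<close> (as in Archimedes' comparison of sphere and cylinder). Hence
  \<open>rho\<close> exceeds \<open>t\<close> with probability \<open>(1 - t) powr (n / 2)\<close>. By independence, for \<open>0 \<le> w \<le> 1\<close>,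
  \<open>1 - \<eta> \<ge> w powr (2 / n)\<close> has probability \<open>(1 - w) ^ N\<close>; writing \<open>1 - \<eta>\<close> as the integral of
  \<open>2 / n * w powr (2 / n - 1)\<close> over those \<open>w\<close> and exchanging integrals gives the beta function.\<close>

section \<open>Orthogonal invariance of Lebesgue measure\<close>

text \<open>The map is the reflection in the hyperplane orthogonal to \<open>a - b\<close>. The
  fixed vectors named in the last clause make it possible to move a second vector without disturbing
  one already placed.\<close>

lemma orthogonal_reflection_exists:
  fixes a b :: "'a::real_inner"
  assumes "norm a = norm b"
  obtains f where "orthogonal_transformation f" "f a = b"
    "\<And>x. x \<bullet> a = x \<bullet> b \<Longrightarrow> f x = x"
proof -
  define d where "d = a - b"
  \<comment> \<open>For \<open>d = 0\<close> the quotient is 0 by convention, so \<open>f\<close> is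
    the identity, as it should be when \<open>a = b\<close>.\<close>
  define f where "f x = x - (2 * (x \<bullet> d) / (d \<bullet> d)) *\<^sub>R d" for x
  have "linear f"
    unfolding f_def
    by (intro linearI) (simp_all add: algebra_simps add_divide_distrib)
  moreover have "f v \<bullet> f w = v \<bullet> w" for v w
    by (cases "d = 0") (simp_all add: f_def inner_diff_left inner_diff_right inner_commute)
  ultimately have "orthogonal_transformation f"
    by (simp add: orthogonal_transformation_def)
  moreover have "f a = b"
  proof (cases "d = 0")
    case False
    have "a \<bullet> a = b \<bullet> b"
      using assms by (simp add: norm_eq)
    \<comment> \<open>Equal norms make the coefficient of \<open>d\<close> in \<open>f a\<close>
      equal to 1, so \<open>f a = a - d = b\<close>.\<close>
    then have "2 * (a \<bullet> d) = d \<bullet> d"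
      by (simp add: d_def inner_diff_left inner_diff_right inner_commute)
    with False show ?thesis
      by (simp add: f_def) (simp add: d_def)
  qed (simp add: f_def d_def)
  moreover have "f x = x" if "x \<bullet> a = x \<bullet> b" for x
    using that by (simp add: f_def d_def inner_diff_right)
  ultimately show thesis
    by (rule that)
qed

text \<open>Integrate \<open>indicator B y * indicator A (x + y)\<close>, for \<open>B\<close> the unit ball, against the product of the two measures
  in both orders.\<close>

lemma translation_invariant_eq_lborel:
  fixes \<mu> :: "'a::euclidean_space measure"
  assumes "sigma_finite_measure \<mu>" and sets [measurable_cong]: "sets \<mu> = sets borel"
    and inv: "\<And>a. distr \<mu> borel ((+) a) = \<mu>"
    and ball: "emeasure \<mu> (ball 0 1) = emeasure lborel (ball (0::'a) 1)"
  shows "\<mu> = lborel"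
proof (rule measure_eqI)
  interpret \<mu>: sigma_finite_measure \<mu> by fact
  interpret P: pair_sigma_finite lborel \<mu> ..
  fix A assume "A \<in> sets \<mu>"
  then have [measurable]: "A \<in> sets borel"
    by (simp add: sets)
  define B where "B = ball (0::'a) 1"
  have [measurable]: "B \<in> sets borel"
    by (simp add: B_def)
  then have B: "B \<in> sets \<mu>"
    by (simp add: sets)
  have pair: "sets (lborel \<Otimes>\<^sub>M \<mu>) = sets (borel \<Otimes>\<^sub>M borel)"
    by (rule sets_pair_measure_cong) (simp_all add: sets)
  have \<mu>_shift: "(\<integral>\<^sup>+y. h y \<partial>\<mu>) = (\<integral>\<^sup>+y. h (x + y) \<partial>\<mu>)" if [measurable]: "h \<in> borel_measurable borel" for h x
    by (subst (1) inv[of x, symmetric], subst nn_integral_distr) auto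
  have L_shift: "(\<integral>\<^sup>+y. h y \<partial>lborel) = (\<integral>\<^sup>+y. h (y + x) \<partial>lborel)"
    if [measurable]: "h \<in> borel_measurable borel" for h and x :: 'a
    by (subst (1) lborel_distr_plus[of x, symmetric], subst nn_integral_distr) (auto simp: add.commute)
  have "emeasure lborel A * emeasure \<mu> B = (\<integral>\<^sup>+y. indicator B y * (\<integral>\<^sup>+x. indicator A x \<partial>lborel) \<partial>\<mu>)"
    by (simp only: nn_integral_multc[OF borel_measurable_indicator[OF B]] nn_integral_indicator[OF B])
       (simp add: mult.commute)
  \<comment> \<open>Translation invariance of \<open>lborel\<close> in the inner integral.\<close>
  also have "\<dots> = (\<integral>\<^sup>+y. \<integral>\<^sup>+x. indicator B y * indicator A (x + y) \<partial>lborel \<partial>\<mu>)"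
  proof (rule nn_integral_cong)
    fix y :: 'a
    have "(\<integral>\<^sup>+x. indicator A x \<partial>lborel) = (\<integral>\<^sup>+x. indicator A (x + y) \<partial>lborel)"
      by (rule L_shift) measurable
    then show "indicator B y * (\<integral>\<^sup>+x. indicator A x \<partial>lborel) =
        (\<integral>\<^sup>+x. indicator B y * indicator A (x + y) \<partial>lborel)"
      by (simp add: nn_integral_cmult)
  qed
  also have "\<dots> = (\<integral>\<^sup>+x. \<integral>\<^sup>+y. indicator B y * indicator A (x + y) \<partial>\<mu> \<partial>lborel)"
    by (rule P.Fubini', subst measurable_cong_sets[OF pair refl]) measurable
  \<comment> \<open>Translation invariance of the other measure: \<open>y\<close> is replaced by
    \<open>y - x\<close>.\<close>
  also have "\<dots> = (\<integral>\<^sup>+x. \<integral>\<^sup>+y. indicator B (y - x) * indicator A y \<partial>\<mu> \<partial>lborel)"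
  proof (rule nn_integral_cong)
    fix x :: 'a
    show "(\<integral>\<^sup>+y. indicator B y * indicator A (x + y) \<partial>\<mu>) = (\<integral>\<^sup>+y. indicator B (y - x) * indicator A y \<partial>\<mu>)"
      by (subst (2) \<mu>_shift[of _ x]) auto
  qed
  also have "\<dots> = (\<integral>\<^sup>+y. \<integral>\<^sup>+x. indicator B (y - x) * indicator A y \<partial>lborel \<partial>\<mu>)"
    by (rule P.Fubini'[symmetric], subst measurable_cong_sets[OF pair refl]) measurable
  \<comment> \<open>For fixed \<open>y\<close>, the points \<open>x\<close> with
    \<open>y - x\<close> in \<open>B\<close> form the unit ball around \<open>y\<close>, whose
    volume does not depend on \<open>y\<close>.\<close>
  also have "\<dots> = (\<integral>\<^sup>+y. indicator A y * emeasure lborel B \<partial>\<mu>)"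
  proof (rule nn_integral_cong)
    fix y :: 'a
    have "(\<integral>\<^sup>+x. indicator B (y - x) * indicator A y \<partial>lborel) = (\<integral>\<^sup>+x. indicator (ball y 1) x * indicator A y \<partial>lborel)"
      by (intro nn_integral_cong) (auto simp: B_def indicator_def dist_norm norm_minus_commute)
    also have "\<dots> = indicator A y * emeasure lborel B"
      by (subst nn_integral_multc) (auto intro!: borel_measurable_indicator simp: B_def emeasure_ball mult.commute)
    finally show "(\<integral>\<^sup>+x. indicator B (y - x) * indicator A y \<partial>lborel) = indicator A y * emeasure lborel B" .
  qed
  also have "\<dots> = emeasure \<mu> A * emeasure lborel B"
    by (simp add: nn_integral_multc sets)
  \<comment> \<open>Both measures agree on \<open>B\<close>, and this common value is positive and
    finite, so it cancels.\<close>
  finally show "emeasure \<mu> A = emeasure lborel A"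
    by (simp add: B_def ball emeasure_ball mult.commute[of _ "ennreal _"] ennreal_mult_cancel_left
      less_imp_neq[OF unit_ball_vol_pos, symmetric])
qed (simp add: sets)

text \<open>The image measure is again translation invariant, and it gives the unit ball its usual
  volume because \<open>f\<close> preserves norms; these properties characterise Lebesgue
  measure.\<close>

lemma lborel_distr_orthogonal_transformation:
  fixes f :: "'a::euclidean_space \<Rightarrow> 'a"
  assumes f: "orthogonal_transformation f"
  shows "distr lborel borel f = lborel"
proof (rule translation_invariant_eq_lborel)
  have "linear f" and norm: "norm (f x) = norm x" for x
    using f by (auto simp: orthogonal_transformation)
  then have [measurable]: "f \<in> borel_measurable borel"
    by (intro borel_measurable_continuous_onI linear_continuous_on) (simp add: linear_conv_bounded_linear)
  have vimage: "f -` ball 0 r = ball 0 r" for r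
    by (auto simp: norm)
  show "sigma_finite_measure (distr lborel borel f)"
  proof (rule sigma_finite_measure.intro, intro exI conjI)
    show "(\<Union> (range (\<lambda>n::nat. ball (0::'a) n))) = space (distr lborel borel f)"
      by (auto intro: reals_Archimedean2)
    show "\<forall>a\<in>range (\<lambda>n::nat. ball 0 n). emeasure (distr lborel borel f) a \<noteq> \<infinity>"
      by (auto simp: emeasure_distr vimage emeasure_ball)
  qed auto
  show "distr (distr lborel borel f) borel ((+) a) = distr lborel borel f" for a
  proof -
    obtain b where b: "f b = a"
      using orthogonal_transformation_surj[OF f] by (metis surjD)
    \<comment> \<open>By linearity \<open>a + f x = f (b + x)\<close>, so a shift after
      \<open>f\<close> becomes a shift before \<open>f\<close>, which \<open>lborel\<close>
      absorbs.\<close>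
    have "distr (distr lborel borel f) borel ((+) a) = distr (distr lborel borel ((+) b)) borel f"
      by (simp add: distr_distr comp_def linear_add[OF \<open>linear f\<close>] b)
    then show ?thesis
      by (simp add: lborel_distr_plus)
  qed
  show "emeasure (distr lborel borel f) (ball 0 1) = emeasure lborel (ball (0::'a) 1)"
    by (simp add: emeasure_distr vimage)
qed simp

section \<open>Areas of discs and annuli\<close>

text \<open>The parameter \<open>r\<close> is the squared radius, which makes the area linear in it.
  For negative \<open>r\<close> the disc is empty and \<open>ennreal\<close> truncates
  \<open>pi * r\<close> to 0, so one formula covers all slices.\<close>

lemma emeasure_disc_PiM:
  fixes b1 b2 :: 'i
  assumes "b1 \<noteq> b2"
  defines "D \<equiv> Pi\<^sub>M {b1, b2} (\<lambda>_. lborel :: real measure)"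
  shows "emeasure D {y \<in> space D. (\<Sum>i\<in>{b1, b2}. (y i)\<^sup>2) \<le> r} = ennreal (pi * r)"
proof -
  have [measurable]: "{y \<in> space D. (\<Sum>i\<in>{b1, b2}. (y i)\<^sup>2) \<le> s} \<in> sets D" for s
    unfolding D_def by measurable
  have pos: "emeasure D {y \<in> space D. (\<Sum>i\<in>{b1, b2}. (y i)\<^sup>2) \<le> s} = ennreal (pi * s)" if "s > 0" for s
  proof -
    have "{y \<in> space D. (\<Sum>i\<in>{b1, b2}. (y i)\<^sup>2) \<le> s} =
        {y. sqrt (\<Sum>i\<in>{b1, b2}. (y i)\<^sup>2) \<le> sqrt s} \<inter> space D"
      by (auto simp del: sum.insert)
    then show ?thesis
      using emeasure_cball_aux[of "{b1, b2}" "sqrt s"] that assms(1)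
      by (simp add: D_def unit_ball_vol_2 del: sum.insert)
  qed
  consider "r > 0" | "r = 0" | "r < 0" by linarith
  then show ?thesis
  proof cases
    case 1
    then show ?thesis by (rule pos)
  next
    case 2
    \<comment> \<open>The degenerate disc lies in the disc of squared radius \<open>e / pi\<close>,
      which has area \<open>e\<close>, for every \<open>e > 0\<close>.\<close>
    have *: "emeasure D {y \<in> space D. (\<Sum>i\<in>{b1, b2}. (y i)\<^sup>2) \<le> r} \<le> 0 + ennreal e" if "e > 0" for e
    proof -
      have "emeasure D {y \<in> space D. (\<Sum>i\<in>{b1, b2}. (y i)\<^sup>2) \<le> r} \<le>
          emeasure D {y \<in> space D. (\<Sum>i\<in>{b1, b2}. (y i)\<^sup>2) \<le> e / pi}"
      proof (rule emeasure_mono)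
        have "r \<le> e / pi" using 2 that by simp
        then show "{y \<in> space D. (\<Sum>i\<in>{b1, b2}. (y i)\<^sup>2) \<le> r} \<subseteq>
            {y \<in> space D. (\<Sum>i\<in>{b1, b2}. (y i)\<^sup>2) \<le> e / pi}"
          by fastforce
      qed measurable
      also have "\<dots> = ennreal e"
        using that by (subst pos) auto
      finally show ?thesis by simp
    qed
    have "emeasure D {y \<in> space D. (\<Sum>i\<in>{b1, b2}. (y i)\<^sup>2) \<le> r} \<le> 0"
      by (rule ennreal_le_epsilon) (rule *)
    with 2 show ?thesis by simp
  next
    case 3
    have "\<not> (\<Sum>i\<in>{b1, b2}. (y i)\<^sup>2) \<le> r" for y :: "'i \<Rightarrow> real"
      using 3 sum_nonneg[of "{b1, b2}" "\<lambda>i. (y i)\<^sup>2"] by (simp del: sum.insert)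
    with 3 show ?thesis
      by (simp add: ennreal_neg mult_nonneg_nonpos del: sum.insert)
  qed
qed

text \<open>Since area is linear in the squared radius, the area of an annulus depends only on the
  difference \<open>s - t\<close>. For \<open>s < t\<close> both sides vanish.\<close>

lemma emeasure_annulus_PiM:
  fixes b1 b2 :: 'i
  assumes "b1 \<noteq> b2" and "t \<ge> 0"
  defines "D \<equiv> Pi\<^sub>M {b1, b2} (\<lambda>_. lborel :: real measure)"
  shows "emeasure D {y \<in> space D. t < (\<Sum>i\<in>{b1, b2}. (y i)\<^sup>2) \<and> (\<Sum>i\<in>{b1, b2}. (y i)\<^sup>2) \<le> s} =
    emeasure D {y \<in> space D. (\<Sum>i\<in>{b1, b2}. (y i)\<^sup>2) \<le> s - t}"
    (is "emeasure D ?A = _")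
proof (cases "t \<le> s")
  case True
  let ?D = "\<lambda>r. {y \<in> space D. (\<Sum>i\<in>{b1, b2}. (y i)\<^sup>2) \<le> r}"
  note disc = emeasure_disc_PiM[OF assms(1), folded D_def]
  have [measurable]: "?D r \<in> sets D" for r
    unfolding D_def by measurable
  have "?A = ?D s - ?D t"
    by (auto simp del: sum.insert)
  also have "emeasure D \<dots> = emeasure D (?D s) - emeasure D (?D t)"
    using True by (intro emeasure_Diff) (auto simp: disc simp del: sum.insert)
  also have "\<dots> = emeasure D (?D (s - t))"
    using assms(2) by (simp only: disc) (simp add: ennreal_minus right_diff_distrib)
  finally show ?thesis .
next
  case False
  then have "?A = {}"
    by (auto simp del: sum.insert)
  with False show ?thesis
    by (simp only: emeasure_disc_PiM[OF assms(1), folded D_def])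
       (simp add: ennreal_neg mult_nonneg_nonpos)
qed

section \<open>Volume of the ball outside a cylinder\<close>

text \<open>Tonelli for a splitting of the coordinates: the outer variable selects a slice and the
  inner one runs through it.\<close>

lemma nn_integral_lborel_merge:
  fixes f :: "'a::euclidean_space \<Rightarrow> ennreal"
  assumes IJ: "I \<inter> J = {}" "I \<union> J = (Basis :: 'a set)"
    and [measurable]: "f \<in> borel_measurable borel"
  shows "(\<integral>\<^sup>+x. f x \<partial>lborel) =
    (\<integral>\<^sup>+y. \<integral>\<^sup>+z. f (\<Sum>b\<in>Basis. merge I J (y, z) b *\<^sub>R b) \<partial>Pi\<^sub>M J (\<lambda>_. lborel) \<partial>Pi\<^sub>M I (\<lambda>_. lborel))"
proof -
  interpret product_sigma_finite "\<lambda>_. lborel :: real measure" by standard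
  have fin: "finite I" "finite J"
    using IJ(2) finite_Basis by (metis finite_Un)+
  have "(\<integral>\<^sup>+x. f x \<partial>lborel) =
      (\<integral>\<^sup>+x. f (\<Sum>b\<in>Basis. x b *\<^sub>R b) \<partial>Pi\<^sub>M (I \<union> J) (\<lambda>_. lborel))"
    by (subst lborel_eq, subst nn_integral_distr) (auto simp: IJ(2))
  also have "\<dots> = (\<integral>\<^sup>+y. \<integral>\<^sup>+z. f (\<Sum>b\<in>Basis. merge I J (y, z) b *\<^sub>R b)
      \<partial>Pi\<^sub>M J (\<lambda>_. lborel) \<partial>Pi\<^sub>M I (\<lambda>_. lborel))"
    using IJ(1) fin by (rule product_nn_integral_fold) (simp add: IJ(2))
  finally show ?thesis .
qed

text \<open>Fix the other coordinates \<open>z\<close>. The left slice is an annulus with squared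
  radii \<open>t\<close> and \<open>1 - |z|^2\<close>; the right slice is a disc of squared radius
  \<open>1 - t - |z|^2\<close>. Their areas agree, so the volumes do.\<close>

lemma emeasure_cball_outside_coordinate_cylinder:
  fixes b1 b2 :: "'a::euclidean_space"
  assumes b: "b1 \<in> Basis" "b2 \<in> Basis" "b1 \<noteq> b2" and t: "0 \<le> t" "t \<le> 1"
  shows "emeasure lborel {x \<in> cball 0 1. t < (b1 \<bullet> x)\<^sup>2 + (b2 \<bullet> x)\<^sup>2} =
    emeasure lborel (cball (0::'a) (sqrt (1 - t)))"
proof -
  define I where "I = {b1, b2}"
  define J where "J = Basis - I"
  let ?x = "\<lambda>y z. \<Sum>b\<in>Basis. merge J I (z, y) b *\<^sub>R b :: 'a"
  let ?q = "\<lambda>K y. \<Sum>i\<in>K. (y i)\<^sup>2 :: real"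
  let ?D = "Pi\<^sub>M I (\<lambda>_. lborel :: real measure)"
  let ?S = "{x \<in> cball (0::'a) 1. t < (b1 \<bullet> x)\<^sup>2 + (b2 \<bullet> x)\<^sup>2}"
  have JI: "J \<inter> I = {}" "J \<union> I = Basis"
    using b by (auto simp: I_def J_def)
  have fin: "finite J" "finite I"
    by (auto simp: I_def J_def)
  have norm: "(norm (?x y z))\<^sup>2 = ?q J z + ?q I y" for y z
  proof -
    have "(norm (?x y z))\<^sup>2 = (\<Sum>b\<in>J \<union> I. (merge J I (z, y) b)\<^sup>2)"
      unfolding JI power2_norm_eq_inner
      by (subst euclidean_inner) (simp add: power2_eq_square)
    also have "\<dots> = (\<Sum>b\<in>J. (merge J I (z, y) b)\<^sup>2) + (\<Sum>b\<in>I. (merge J I (z, y) b)\<^sup>2)"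
      by (rule sum.union_disjoint) (use fin JI in auto)
    also have "\<dots> = ?q J z + ?q I y"
      using JI by (intro arg_cong2[where f = plus] sum.cong) auto
    finally show ?thesis .
  qed
  have q: "(b1 \<bullet> ?x y z)\<^sup>2 + (b2 \<bullet> ?x y z)\<^sup>2 = ?q I y" for y z
    using b JI by (simp add: inner_commute[of b1] inner_commute[of b2]) (auto simp: I_def)
  have mem: "?x y z \<in> cball 0 r \<longleftrightarrow> ?q I y \<le> r\<^sup>2 - ?q J z" if "r \<ge> 0" for y z r
    using that norm[of z y] abs_le_square_iff[of "norm (?x y z)" r] by (auto simp: algebra_simps)
  have "?S \<in> sets borel"
    by measurable
  then have "emeasure lborel ?S = (\<integral>\<^sup>+z. \<integral>\<^sup>+y. indicator ?S (?x y z) \<partial>?D \<partial>Pi\<^sub>M J (\<lambda>_. lborel))"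
    by (subst nn_integral_indicator[symmetric], simp, subst nn_integral_lborel_merge[OF JI]) auto
  also have "\<dots> = (\<integral>\<^sup>+z. \<integral>\<^sup>+y. indicator (cball 0 (sqrt (1 - t))) (?x y z) \<partial>?D \<partial>Pi\<^sub>M J (\<lambda>_. lborel))"
  proof (rule nn_integral_cong)
    fix z
    have "(\<integral>\<^sup>+y. indicator ?S (?x y z) \<partial>?D) =
        (\<integral>\<^sup>+y. indicator {y \<in> space ?D. t < ?q I y \<and> ?q I y \<le> 1 - ?q J z} y \<partial>?D)"
      using mem[of 1 z] q[of z] by (intro nn_integral_cong) (auto simp: indicator_def)
    also have "\<dots> = emeasure ?D {y \<in> space ?D. t < ?q I y \<and> ?q I y \<le> 1 - ?q J z}"
      using fin by (intro nn_integral_indicator) measurable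
    also have "\<dots> = emeasure ?D {y \<in> space ?D. ?q I y \<le> 1 - ?q J z - t}"
      unfolding I_def using b(3) t(1) by (rule emeasure_annulus_PiM)
    also have "\<dots> = (\<integral>\<^sup>+y. indicator {y \<in> space ?D. ?q I y \<le> 1 - ?q J z - t} y \<partial>?D)"
      using fin by (intro nn_integral_indicator[symmetric]) measurable
    also have "\<dots> = (\<integral>\<^sup>+y. indicator (cball 0 (sqrt (1 - t))) (?x y z) \<partial>?D)"
      using mem[of "sqrt (1 - t)" z] t by (intro nn_integral_cong) (auto simp: indicator_def)
    finally show "(\<integral>\<^sup>+y. indicator ?S (?x y z) \<partial>?D) =
      (\<integral>\<^sup>+y. indicator (cball 0 (sqrt (1 - t))) (?x y z) \<partial>?D)" .
  qed
  also have "\<dots> = emeasure lborel (cball (0::'a) (sqrt (1 - t)))"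
    by (subst nn_integral_indicator[symmetric], simp, subst nn_integral_lborel_merge[OF JI])
       (auto intro!: borel_measurable_indicator)
  finally show ?thesis .
qed

text \<open>An orthogonal map carries \<open>u\<close> and \<open>v\<close> to two basis vectors
  while preserving the ball and its volume, which reduces the claim to the coordinate case.\<close>

lemma emeasure_cball_outside_cylinder:
  fixes u v :: "'a::euclidean_space"
  assumes dim: "DIM('a) \<ge> 2" and uv: "norm u = 1" "norm v = 1" "u \<bullet> v = 0"
    and t: "0 \<le> t" "t \<le> 1"
  shows "emeasure lborel {x \<in> cball 0 1. t < (u \<bullet> x)\<^sup>2 + (v \<bullet> x)\<^sup>2} =
    emeasure lborel (cball (0::'a) (sqrt (1 - t)))"
proof -
  obtain B where "B \<subseteq> (Basis :: 'a set)" "card B = 2"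
    using dim by (metis obtain_subset_with_card_n)
  then obtain b1 b2 :: 'a where b: "b1 \<in> Basis" "b2 \<in> Basis" "b1 \<noteq> b2"
    by (auto simp: card_2_iff)
  obtain f where f: "orthogonal_transformation f" "f u = b1"
    using uv b by (metis norm_Basis orthogonal_reflection_exists)
  have inner_f: "f x \<bullet> f y = x \<bullet> y" for x y
    using f(1) by (simp add: orthogonal_transformation_def)
  have "b1 \<bullet> f v = 0"
    using uv(3) inner_f[of u v] f(2) by simp
  moreover have "norm (f v) = norm b2"
    using uv(2) b(2) f(1) by (simp add: orthogonal_transformation)
  \<comment> \<open>The second reflection fixes \<open>b1\<close>, because \<open>b1\<close> is
    orthogonal to both \<open>f v\<close> and \<open>b2\<close>.\<close>
  ultimately obtain g where g: "orthogonal_transformation g" "g (f v) = b2" "g b1 = b1"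
    using b by (metis inner_Basis orthogonal_reflection_exists)
  define h where "h = g \<circ> f"
  have h: "orthogonal_transformation h"
    unfolding h_def using g(1) f(1) by (rule orthogonal_transformation_compose)
  have h_inner: "b1 \<bullet> h x = u \<bullet> x" "b2 \<bullet> h x = v \<bullet> x" for x
  proof -
    have *: "h y \<bullet> h x = y \<bullet> x" for y
      using h by (simp add: orthogonal_transformation_def)
    show "b1 \<bullet> h x = u \<bullet> x" "b2 \<bullet> h x = v \<bullet> x"
      using *[of u] *[of v] f(2) g by (simp_all add: h_def)
  qed
  have norm_h: "norm (h x) = norm x" for x
    using h by (simp add: orthogonal_transformation)
  have [measurable]: "h \<in> borel_measurable borel"
    using h by (intro borel_measurable_continuous_onI linear_continuous_on)
      (simp add: linear_conv_bounded_linear[symmetric] orthogonal_transformation_linear)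
  let ?S = "{x \<in> cball (0::'a) 1. t < (b1 \<bullet> x)\<^sup>2 + (b2 \<bullet> x)\<^sup>2}"
  have "{x \<in> cball 0 1. t < (u \<bullet> x)\<^sup>2 + (v \<bullet> x)\<^sup>2} = h -` ?S \<inter> space lborel"
    by (auto simp: h_inner norm_h)
  also have "emeasure lborel \<dots> = emeasure (distr lborel borel h) ?S"
    by (rule emeasure_distr[symmetric]) measurable
  also have "\<dots> = emeasure lborel (cball (0::'a) (sqrt (1 - t)))"
    using emeasure_cball_outside_coordinate_cylinder[OF b t]
    by (simp add: lborel_distr_orthogonal_transformation[OF h])
  finally show ?thesis .
qed

text \<open>The part outside the cylinder has the volume of a ball of radius
  \<open>sqrt (1 - t)\<close>, hence relative volume \<open>(1 - t) powr (n / 2)\<close>. The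
  threshold is chosen so that this equals \<open>w\<close>.\<close>

lemma measure_uniform_cball_cylinder:
  fixes u v :: "'a::euclidean_space"
  assumes dim: "DIM('a) \<ge> 2" and uv: "norm u = 1" "norm v = 1" "u \<bullet> v = 0"
    and w: "0 \<le> w" "w \<le> 1"
  shows "measure (uniform_measure lborel (cball 0 1))
    {x. (u \<bullet> x)\<^sup>2 + (v \<bullet> x)\<^sup>2 \<le> 1 - w powr (2 / real DIM('a))} = 1 - w"
proof -
  let ?n = "real DIM('a)" and ?Q = "cball (0::'a) 1"
  let ?U = "uniform_measure lborel ?Q"
  let ?t = "1 - w powr (2 / ?n)"
  have Q: "emeasure lborel ?Q \<noteq> 0" "emeasure lborel ?Q \<noteq> \<infinity>"
    by (simp_all add: emeasure_cball less_imp_neq[OF unit_ball_vol_pos, symmetric])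
  interpret prob_space ?U
    using Q by (rule prob_space_uniform_measure)
  have w': "0 \<le> w powr (2 / ?n)" "w powr (2 / ?n) \<le> 1"
    using w by (auto intro: powr_le1)
  have root: "sqrt (w powr (2 / ?n)) ^ DIM('a) = w"
  proof (cases "w = 0")
    case False
    with w show ?thesis
      by (simp add: powr_half_sqrt[symmetric] powr_powr powr_realpow[symmetric])
  qed (simp add: zero_power)
  have meas: "{x. ?t < (u \<bullet> x)\<^sup>2 + (v \<bullet> x)\<^sup>2} \<in> sets lborel"
    by measurable
  have "prob {x. ?t < (u \<bullet> x)\<^sup>2 + (v \<bullet> x)\<^sup>2} =
      measure lborel (?Q \<inter> {x. ?t < (u \<bullet> x)\<^sup>2 + (v \<bullet> x)\<^sup>2}) / measure lborel ?Q"
    using Q meas by (intro measure_uniform_measure) auto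
  also have "?Q \<inter> {x. ?t < (u \<bullet> x)\<^sup>2 + (v \<bullet> x)\<^sup>2} = {x \<in> ?Q. ?t < (u \<bullet> x)\<^sup>2 + (v \<bullet> x)\<^sup>2}"
    by auto
  also have "measure lborel \<dots> = measure lborel (cball (0::'a) (sqrt (w powr (2 / ?n))))"
    using emeasure_cball_outside_cylinder[OF dim uv, of ?t] w' by (simp add: measure_def)
  also have "\<dots> / measure lborel ?Q = w"
    using w' by (simp add: content_cball root less_imp_neq[OF unit_ball_vol_pos, symmetric])
  finally have "prob {x. ?t < (u \<bullet> x)\<^sup>2 + (v \<bullet> x)\<^sup>2} = w" .
  moreover have "{x. (u \<bullet> x)\<^sup>2 + (v \<bullet> x)\<^sup>2 \<le> ?t} = space ?U - {x. ?t < (u \<bullet> x)\<^sup>2 + (v \<bullet> x)\<^sup>2}"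
    by auto
  ultimately show ?thesis
    using meas by (subst \<open>_ = space ?U - _\<close>) (subst prob_compl, auto)
qed

section \<open>From tail probabilities to the beta function\<close>

text \<open>A layer-cake argument in the parameter \<open>w\<close>, with levels
  \<open>w powr a\<close>: exchanging the integrals leaves \<open>a * w powr (a - 1)\<close> times
  the tail \<open>(1 - w) ^ N\<close>, an Euler integrand.\<close>

lemma (in prob_space) expectation_eq_Beta:
  fixes Z :: "'a \<Rightarrow> real" and N :: nat and a :: real
  assumes a: "a > 0" and N: "N \<ge> 1" and [measurable]: "Z \<in> borel_measurable M"
    and le1: "\<And>\<omega>. \<omega> \<in> space M \<Longrightarrow> Z \<omega> \<le> 1"
    and tail: "\<And>w. 0 \<le> w \<Longrightarrow> w \<le> 1 \<Longrightarrow> \<P>(\<omega> in M. w powr a \<le> Z \<omega>) = (1 - w) ^ N"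
  shows "expectation Z = a * Beta a (real N + 1)"
proof -
  interpret P: pair_sigma_finite M "lborel :: real measure" ..
  \<comment> \<open>The density is the derivative of \<open>w powr a\<close>. Cutting it off at 1
    loses nothing because \<open>Z\<close> is at most 1.\<close>
  let ?k = "\<lambda>w. ennreal (a * w powr (a - 1)) * indicator {0..1} w"
  \<comment> \<open>At \<open>w = 0\<close> the level is \<open>0 powr a = 0\<close> and the tail
    probability is 1.\<close>
  have "AE \<omega> in M. 0 \<le> Z \<omega>"
    using tail[of 0] a by (subst prob_Collect_eq_1[symmetric]) auto
  have layer: "ennreal (Z \<omega>) = (\<integral>\<^sup>+w. ?k w * indicator {w. w powr a \<le> Z \<omega>} w \<partial>lborel)"
    if "0 \<le> Z \<omega>" "\<omega> \<in> space M" for \<omega>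
  proof -
    have iff: "w powr a \<le> Z \<omega> \<longleftrightarrow> w \<le> Z \<omega> powr (1 / a)" if "w \<ge> 0" for w
    proof -
      have "w = (w powr a) powr (1 / a)" "Z \<omega> = (Z \<omega> powr (1 / a)) powr a"
        using a that \<open>0 \<le> Z \<omega>\<close> by (simp_all add: powr_powr)
      then show ?thesis
        using a that \<open>0 \<le> Z \<omega>\<close> by (metis powr_ge_zero powr_mono2 less_imp_le zero_less_divide_1_iff)
    qed
    have "Z \<omega> powr (1 / a) \<le> 1"
      using that le1 a by (intro powr_le1) auto
    then have "(\<integral>\<^sup>+w. ?k w * indicator {w. w powr a \<le> Z \<omega>} w \<partial>lborel) =
        (\<integral>\<^sup>+w. ennreal (a * w powr (a - 1)) * indicator {0..Z \<omega> powr (1 / a)} w \<partial>lborel)"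
      using iff by (intro nn_integral_cong) (auto simp: indicator_def)
    also have "((\<lambda>w. a * w powr (a - 1)) has_integral Z \<omega>) {0..Z \<omega> powr (1 / a)}"
      using has_integral_mult_right[OF has_integral_powr_from_0[of "a - 1" "Z \<omega> powr (1 / a)"], of a] a that
      by (simp add: powr_powr)
    then have "(\<integral>\<^sup>+w. ennreal (a * w powr (a - 1)) * indicator {0..Z \<omega> powr (1 / a)} w \<partial>lborel) =
        ennreal (Z \<omega>)"
      using a by (intro nn_integral_has_integral_lebesgue') auto
    finally show ?thesis by simp
  qed
  have "(\<integral>\<^sup>+\<omega>. ennreal (Z \<omega>) \<partial>M) =
      (\<integral>\<^sup>+\<omega>. \<integral>\<^sup>+w. ?k w * indicator {w. w powr a \<le> Z \<omega>} w \<partial>lborel \<partial>M)"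
    using \<open>AE \<omega> in M. 0 \<le> Z \<omega>\<close> by (intro nn_integral_cong_AE) (auto elim!: AE_mp simp: layer)
  also have "\<dots> = (\<integral>\<^sup>+w. \<integral>\<^sup>+\<omega>. ?k w * indicator {w. w powr a \<le> Z \<omega>} w \<partial>M \<partial>lborel)"
    by (rule P.Fubini'[symmetric]) measurable
  also have "\<dots> = (\<integral>\<^sup>+w. ennreal (a * (w powr (a - 1) * (1 - w) powr (real N + 1 - 1))) * indicator {0..1} w \<partial>lborel)"
  proof (rule nn_integral_cong)
    fix w :: real
    have "(\<integral>\<^sup>+\<omega>. ?k w * indicator {w. w powr a \<le> Z \<omega>} w \<partial>M) =
        ?k w * (\<integral>\<^sup>+\<omega>. indicator {\<omega> \<in> space M. w powr a \<le> Z \<omega>} \<omega> \<partial>M)"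
      by (subst nn_integral_cmult[symmetric]) (auto intro!: nn_integral_cong simp: indicator_def)
    also have "\<dots> = ?k w * ennreal (\<P>(\<omega> in M. w powr a \<le> Z \<omega>))"
      by (simp add: emeasure_eq_measure)
    \<comment> \<open>Turning \<open>(1 - w) ^ N\<close> into \<open>powr\<close> at
      \<open>w = 1\<close> needs \<open>N\<close> nonzero, as \<open>0 powr 0 = 0\<close> but
      \<open>0 ^ 0 = 1\<close>.\<close>
    also have "\<dots> = ennreal (a * (w powr (a - 1) * (1 - w) powr (real N + 1 - 1))) * indicator {0..1} w"
      using a N by (auto simp: indicator_def tail powr_realpow' ennreal_mult'[symmetric] mult.assoc)
    finally show "(\<integral>\<^sup>+\<omega>. ?k w * indicator {w. w powr a \<le> Z \<omega>} w \<partial>M) = \<dots>" .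
  qed
  also have "\<dots> = ennreal (a * Beta a (real N + 1))"
    using a by (intro nn_integral_has_integral_lebesgue' has_integral_mult_right has_integral_Beta_real) auto
  finally have "(\<integral>\<^sup>+\<omega>. ennreal (Z \<omega>) \<partial>M) = ennreal (a * Beta a (real N + 1))" .
  moreover have "0 \<le> a * Beta a (real N + 1)"
    using a by (simp add: Beta_def Gamma_real_pos less_imp_le)
  ultimately show ?thesis
    using \<open>AE \<omega> in M. 0 \<le> Z \<omega>\<close> by (subst integral_eq_nn_integral) auto
qed

section \<open>Distribution and expectation of the empirical maximum\<close>

lemma rho_eq: "rho c1 c2 x = (c1 \<bullet> x)\<^sup>2 + (c2 \<bullet> x)\<^sup>2"
  by (simp add: rho_def g_map_def power2_norm_eq_inner inner_vec_def sum_2)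
     (simp add: power2_eq_square)

theorem theorem4:
  fixes N :: nat
    and Q :: "(real ^ 'n) set"
    and c1 c2 :: "real ^ 'n"
    and P :: "'b measure" and \<xi> :: "'b \<Rightarrow> real ^ 'n"
    and M :: "'a measure" and X :: "nat \<Rightarrow> 'a \<Rightarrow> real ^ 'n"
  assumes "CARD('n) \<ge> 3" and "N \<ge> 1"
    and "Q = cball 0 1"
    and "prob_space P" and "\<xi> \<in> measurable P borel"
    and "distr P borel \<xi> = uniform_measure lborel Q"
    and "norm c1 = 1" and "norm c2 = 1" and "c1 \<bullet> c2 = 0"
    and "prob_space M"
    and "prob_space.indep_vars M (\<lambda>_. borel) X {1..N}"
    and "\<And>i. i \<in> {1..N} \<Longrightarrow> distr M borel (X i) = distr P borel \<xi>"
  shows "prob_space.expectation M (empirical_max (rho c1 c2) N X)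
           = 1 - 2 / real CARD('n) * Beta (2 / real CARD('n)) (real N + 1)"
proof -
  interpret prob_space M by fact
  let ?a = "2 / real CARD('n)"
  let ?\<eta> = "empirical_max (rho c1 c2) N X"
  have X [measurable]: "X i \<in> borel_measurable M" if "i \<in> {1..N}" for i
    using assms(11) that by (simp add: indep_vars_def)
  have [measurable]: "rho c1 c2 \<in> borel_measurable borel"
    unfolding rho_eq[abs_def] by measurable
  have [measurable]: "?\<eta> \<in> borel_measurable M"
    unfolding empirical_max_def[abs_def] using assms(2)
    by (intro borel_measurable_Max) (auto intro: measurable_compose[OF X])
  have le_iff: "?\<eta> \<omega> \<le> s \<longleftrightarrow> (\<forall>i\<in>{1..N}. rho c1 c2 (X i \<omega>) \<le> s)" for \<omega> s
    unfolding empirical_max_def using assms(2) by (subst Max_le_iff) auto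
  have \<eta>_nonneg: "0 \<le> ?\<eta> \<omega>" for \<omega>
  proof -
    have "0 \<le> rho c1 c2 (X 1 \<omega>)"
      by (simp add: rho_def)
    also have "\<dots> \<le> ?\<eta> \<omega>"
      using le_iff[of \<omega> "?\<eta> \<omega>"] assms(2) by auto
    finally show ?thesis .
  qed
  have E: "expectation (\<lambda>\<omega>. 1 - ?\<eta> \<omega>) = ?a * Beta ?a (real N + 1)"
  proof (rule expectation_eq_Beta)
    fix w :: real assume w: "0 \<le> w" "w \<le> 1"
    let ?A = "{x. rho c1 c2 x \<le> 1 - w powr ?a}"
    have A: "?A \<in> sets borel" by measurable
    \<comment> \<open>The maximum is at most a level exactly when every sample value is, so
      independence turns the probability into a product.\<close>
    have "{\<omega> \<in> space M. w powr ?a \<le> 1 - ?\<eta> \<omega>} = (\<Inter>i\<in>{1..N}. X i -` ?A \<inter> space M)"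
      using assms(2) le_iff[of _ "1 - w powr ?a"] by (auto simp: algebra_simps)
    also have "prob \<dots> = (\<Prod>i\<in>{1..N}. prob (X i -` ?A \<inter> space M))"
      using assms(2,11) A by (intro indep_varsD_finite) auto
    also have "\<dots> = (\<Prod>i\<in>{1..N}. 1 - w)"
    proof (rule prod.cong)
      fix i assume i: "i \<in> {1..N}"
      have "prob (X i -` ?A \<inter> space M) = measure (distr M borel (X i)) ?A"
        using X[OF i] A by (simp add: measure_distr)
      also have "\<dots> = 1 - w"
        using measure_uniform_cball_cylinder[of c1 c2 w] w assms(1,7,8,9)
        by (simp add: assms(12)[OF i] assms(3,6) rho_eq)
      finally show "prob (X i -` ?A \<inter> space M) = 1 - w" .
    qed simp
    finally show "\<P>(\<omega> in M. w powr ?a \<le> 1 - ?\<eta> \<omega>) = (1 - w) ^ N"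
      by simp
  qed (use assms(2) \<eta>_nonneg in auto)
  \<comment> \<open>A non-integrable function has Bochner integral 0, so a positive value of the
    expectation forces integrability of \<open>1 - eta\<close>.\<close>
  have "?a * Beta ?a (real N + 1) > 0"
    by (auto simp: Beta_def intro!: mult_pos_pos divide_pos_pos Gamma_real_pos add_nonneg_pos)
  with E have "integrable M (\<lambda>\<omega>. 1 - ?\<eta> \<omega>)"
    using not_integrable_integral_eq[of M "\<lambda>\<omega>. 1 - ?\<eta> \<omega>"] by linarith
  then have "integrable M ?\<eta>"
    using Bochner_Integration.integrable_diff[of M "\<lambda>_. 1" "\<lambda>\<omega>. 1 - ?\<eta> \<omega>"] by simp
  then have "expectation (\<lambda>\<omega>. 1 - ?\<eta> \<omega>) = 1 - expectation ?\<eta>"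
    by (simp add: prob_space)
  with E show ?thesis
    by simp
qed

end
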